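(* Let $D_{\mathcal X}=\mathcal N(\mathbf 0,\boldsymbol\Sigma_{D_{\mathcal X}})$ with $\boldsymbol\Sigma_{D_{\mathcal X}}$ positive definite, let $k\ge d$, and let $(\widetilde{\mathbf x}_1,\dots,\widetilde{\mathbf x}_k)\sim\mathrm{VS}_{D_{\mathcal X}}^k$ form the rows of $\widetilde{\mathbf X}\in\mathbb R^{k\times d}$. Then $\widetilde{\mathbf X}^\top\widetilde{\mathbf X}\sim W_d(k+2,\boldsymbol\Sigma_{D_{\mathcal X}})$.
   Context: $W_d(m,\boldsymbol\Sigma)$ denotes the Wishart distribution with $m$ degrees of freedom and scale $\boldsymbol\Sigma$, i.e. the law of $\sum_{j=1}^m\mathbf z_j\mathbf z_j^\top$ with $\mathbf z_j$ i.i.d. $\mathcal N(\mathbf 0,\boldsymbol\Sigma)$. $\mathrm{VS}_{D_{\mathcal X}}^k$ is the probability measure on $(\mathbb R^d)^k$ given by $\mathrm{VS}_{D_{\mathcal X}}^k(A)=\mathbb E_{D_{\mathcal X}^k}[\mathbf 1_A\det(\sum_{i=1}^k\mathbf x_i\mathbf x_i^\top)]/\big(d!\binom kd\det(\boldsymbol\Sigma_{D_{\mathcal X}})\big)$, where $D_{\mathcal X}^k$ is the law of $k$ i.i.d. draws from $D_{\mathcal X}$ and $\boldsymbol\Sigma_{D_{\mathcal X}}=\mathbb E[\mathbf x\mathbf x^\top]$. *)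

theory Defs
  imports "HOL-Probability.Probability"
begin

definition outer :: "real^'d \<Rightarrow> real^'d \<Rightarrow> real^'d^'d" where
  "outer x y = (\<chi> i j. x $ i * y $ j)"

definition pos_def_matrix :: "real^'d^'d \<Rightarrow> bool" where
  "pos_def_matrix S \<longleftrightarrow> transpose S = S \<and> (\<forall>x. x \<noteq> 0 \<longrightarrow> x \<bullet> (S *v x) > 0)"

definition mvnormal :: "real^'d^'d \<Rightarrow> (real^'d) measure" where
  "mvnormal S = density lborel
     (\<lambda>x. ennreal ((2 * pi) powr (- real CARD('d) / 2) * det S powr (- 1 / 2)
                    * exp (- (x \<bullet> (matrix_inv S *v x)) / 2)))"

definition wishart :: "nat \<Rightarrow> real^'d^'d \<Rightarrow> (real^'d^'d) measure" where
  "wishart m S = distr (PiM {..<m} (\<lambda>_. mvnormal S)) borel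
     (\<lambda>z. \<Sum>j<m. outer (z j) (z j))"

definition second_moment :: "(real^'d) measure \<Rightarrow> real^'d^'d" where
  "second_moment D = (\<chi> i j. integral\<^sup>L D (\<lambda>x. x $ i * x $ j))"

definition volume_sampling :: "nat \<Rightarrow> (real^'d) measure \<Rightarrow> (nat \<Rightarrow> real^'d) measure" where
  "volume_sampling k D = density (PiM {..<k} (\<lambda>_. D))
     (\<lambda>X. ennreal (det (\<Sum>i<k. outer (X i) (X i))
        / (fact CARD('d) * real (k choose CARD('d)) * det (second_moment D))))"

end

theory Submission
  imports Defs
begin

text \<open>
  The two laws are compared through their Laplace transforms. Tilting $\mathcal N(0,S)$ by
  $\exp(-x^T T x)$ gives $r\cdot\mathcal N(0,Q^{-1})$ with $Q = S^{-1} + 2T$ and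
  $r = (\det S\,\det Q)^{-1/2}$, so the Wishart law with $m$ degrees of freedom has Laplace
  transform $r^m$. Expanding the determinant gives
  $E\,\det(\sum_i x_i x_i^T) = d!\binom{k}{d}\det E[xx^T]$ for i.i.d. vectors; applied to the tilted
  law, this shows that volume sampling of size $k$ has Laplace transform
  $r^k\det(Q^{-1})/\det S = r^{k+2}$.
\<close>

subsection \<open>Linear change of variables for Lebesgue measure\<close>

text \<open>Comparing densities would call for a change of variables on the space of symmetric
  matrices. Laplace transforms need only Gaussian integrals over vectors, because the exponent of a
  sum of outer products splits into one term per vector; the price is a uniqueness theorem. It rests
  on letting T range over the whole positive semidefinite cone. The cone is closed under addition,
  so a product of kernels exp(-<A,T>) is again a kernel. It contains 0, which yields total masses.
  It contains enough rank-one matrices to separate symmetric matrices. Finitely many kernels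
  therefore map the cone injectively into a compact cube, where polynomial moments determine a
  finite measure. The two extra degrees of freedom come from
  \<open>r^2 = det(Q^{-1}) / det S\<close>: the factor by which tilting changes the determinant of
  the second moment matrix equals the transform contributed by two further Gaussian vectors.\<close>

text \<open>The change of variables theorems of the library require a well-ordered index type.\<close>

lemma nn_integral_lborel_swap_coordinates:
  fixes f :: "real^'d \<Rightarrow> ennreal"
  assumes [measurable]: "f \<in> borel_measurable borel"
  shows "(\<integral>\<^sup>+x. f (\<chi> i. x $ Transposition.transpose m n i) \<partial>lborel) = (\<integral>\<^sup>+x. f x \<partial>lborel)"
proof -
  let ?t = "Transposition.transpose m n"
  let ?T = "\<lambda>x::real^'d. \<chi> i. x $ ?t i"
  have [measurable]: "?T \<in> borel \<rightarrow>\<^sub>M borel"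
    by (intro borel_measurable_continuous_onI continuous_intros)
  have B: "Basis = range (\<lambda>i. axis i 1 :: real^'d)"
    by (auto simp: Basis_vec_def)
  have pB: "(\<Prod>b\<in>Basis. g b) = (\<Prod>i\<in>UNIV. g (axis i 1))" for g :: "real^'d \<Rightarrow> real"
    unfolding B by (subst prod.reindex) (auto simp: inj_on_def axis_eq_axis)
  have "lborel = distr lborel borel ?T"
  proof (rule lborel_eqI)
    fix l u :: "real^'d"
    assume le': "\<And>b. b \<in> Basis \<Longrightarrow> l \<bullet> b \<le> u \<bullet> b"
    have le: "l $ i \<le> u $ i" for i
      using le'[of "axis i 1"] by (simp add: inner_axis)
    \<comment> \<open>A transposition is its own inverse, so the preimage of a box is the box with
      permuted corners, whose volume is the same product in another order.\<close>
    have pre: "?T -` box l u = box (?T l) (?T u)"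
    proof (intro set_eqI iffI)
      fix x assume *: "x \<in> ?T -` box l u"
      then have "l $ i < x $ ?t i \<and> x $ ?t i < u $ i" for i
        by (auto simp: mem_box_cart)
      from this[of "?t _"] show "x \<in> box (?T l) (?T u)"
        by (auto simp: mem_box_cart)
    next
      fix x assume *: "x \<in> box (?T l) (?T u)"
      then have "l $ ?t i < x $ i \<and> x $ i < u $ ?t i" for i
        by (auto simp: mem_box_cart)
      from this[of "?t _"] show "x \<in> ?T -` box l u"
        by (auto simp: mem_box_cart)
    qed
    have "emeasure (distr lborel borel ?T) (box l u) = emeasure lborel (box (?T l) (?T u))"
      by (simp add: emeasure_distr pre)
    also have "\<dots> = (\<Prod>b\<in>Basis. (?T u - ?T l) \<bullet> b)"
      by (rule emeasure_lborel_box) (auto simp: B inner_axis le)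
    also have "(\<Prod>b\<in>Basis. (?T u - ?T l) \<bullet> b) = (\<Prod>i\<in>UNIV. u $ ?t i - l $ ?t i)"
      by (simp add: pB inner_axis)
    also have "\<dots> = (\<Prod>i\<in>UNIV. u $ i - l $ i)"
      by (rule prod.reindex_bij_betw) simp
    also have "\<dots> = (\<Prod>b\<in>Basis. (u - l) \<bullet> b)"
      by (simp add: pB inner_axis)
    finally show "emeasure (distr lborel borel ?T) (box l u) = ennreal (\<Prod>b\<in>Basis. (u - l) \<bullet> b)" .
  qed simp
  then have "(\<integral>\<^sup>+x. f x \<partial>lborel) = (\<integral>\<^sup>+x. f x \<partial>distr lborel borel ?T)"
    by simp
  also have "\<dots> = (\<integral>\<^sup>+x. f (?T x) \<partial>lborel)"
    by (subst nn_integral_distr) auto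
  finally show ?thesis ..
qed

text \<open>With all coordinates other than \<open>a\<close> fixed, the map only translates
  coordinate \<open>a\<close> by the constant \<open>x \<bullet> b\<close>. Fubini then reduces the
  claim to translation invariance of Lebesgue measure on the line.\<close>

lemma nn_integral_lborel_shear:
  fixes f :: "'a::euclidean_space \<Rightarrow> ennreal"
  assumes [measurable]: "f \<in> borel_measurable borel" and ab: "a \<in> Basis" "b \<in> Basis" "a \<noteq> b"
  shows "(\<integral>\<^sup>+x. f (x + (x \<bullet> b) *\<^sub>R a) \<partial>lborel) = (\<integral>\<^sup>+x. f x \<partial>lborel)"
proof -
  interpret product_sigma_finite "\<lambda>_::'a. lborel :: real measure" ..
  let ?B = "Basis - {a} :: 'a set"
  have ins: "Basis = insert a ?B" using ab by auto
  have fub: "(\<integral>\<^sup>+x. g x \<partial>lborel) =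
     (\<integral>\<^sup>+h. (\<integral>\<^sup>+y. g ((\<Sum>c\<in>?B. h c *\<^sub>R c) + y *\<^sub>R a) \<partial>lborel) \<partial>(\<Pi>\<^sub>M b\<in>?B. lborel))"
    if [measurable]: "g \<in> borel_measurable borel" for g :: "'a \<Rightarrow> ennreal"
  proof -
    have "(\<integral>\<^sup>+x. g x \<partial>lborel) = (\<integral>\<^sup>+h. g (\<Sum>b\<in>Basis. h b *\<^sub>R b) \<partial>(\<Pi>\<^sub>M b\<in>Basis. lborel))"
      by (subst lborel_eq, subst nn_integral_distr) auto
    also have "\<dots> = (\<integral>\<^sup>+h. g (\<Sum>b\<in>insert a ?B. h b *\<^sub>R b) \<partial>(\<Pi>\<^sub>M b\<in>insert a ?B. lborel))"
      using ins by simp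
    also have "\<dots> = (\<integral>\<^sup>+h. (\<integral>\<^sup>+y. g (\<Sum>b\<in>insert a ?B. (h(a := y)) b *\<^sub>R b) \<partial>lborel) \<partial>(\<Pi>\<^sub>M b\<in>?B. lborel))"
      by (rule product_nn_integral_insert) auto
    also have "\<dots> = (\<integral>\<^sup>+h. (\<integral>\<^sup>+y. g ((\<Sum>c\<in>?B. h c *\<^sub>R c) + y *\<^sub>R a) \<partial>lborel) \<partial>(\<Pi>\<^sub>M b\<in>?B. lborel))"
    proof (intro nn_integral_cong)
      fix h :: "'a \<Rightarrow> real" and y
      have "(\<Sum>b\<in>?B. (h(a := y)) b *\<^sub>R b) = (\<Sum>c\<in>?B. h c *\<^sub>R c)"
        by (rule sum.cong) auto
      then show "g (\<Sum>b\<in>insert a ?B. (h(a := y)) b *\<^sub>R b) = g ((\<Sum>c\<in>?B. h c *\<^sub>R c) + y *\<^sub>R a)"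
        by (subst sum.insert) (auto simp: add.commute)
    qed
    finally show ?thesis .
  qed
  \<comment> \<open>The shift is constant in the inner integral: since \<open>a\<close> and
    \<open>b\<close> are distinct, it does not depend on \<open>y\<close>.\<close>
  have inner: "((\<Sum>c\<in>?B. h c *\<^sub>R c) + y *\<^sub>R a) \<bullet> b = h b" for h y
  proof -
    have "((\<Sum>c\<in>?B. h c *\<^sub>R c) + y *\<^sub>R a) \<bullet> b = (\<Sum>c\<in>?B. h c * (c \<bullet> b))"
      using ab by (simp add: inner_add_left inner_sum_left inner_not_same_Basis)
    also have "\<dots> = (\<Sum>c\<in>?B. if c = b then h c else 0)"
      using ab by (intro sum.cong) (auto simp: inner_Basis)
    finally have "((\<Sum>c\<in>?B. h c *\<^sub>R c) + y *\<^sub>R a) \<bullet> b = (\<Sum>c\<in>?B. if c = b then h c else 0)" .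
    then show ?thesis using ab by simp
  qed
  have "(\<integral>\<^sup>+x. f (x + (x \<bullet> b) *\<^sub>R a) \<partial>lborel) =
     (\<integral>\<^sup>+h. (\<integral>\<^sup>+y. f ((\<Sum>c\<in>?B. h c *\<^sub>R c) + y *\<^sub>R a + h b *\<^sub>R a) \<partial>lborel) \<partial>(\<Pi>\<^sub>M b\<in>?B. lborel))"
    by (subst fub) (simp_all add: inner)
  also have "\<dots> = (\<integral>\<^sup>+h. (\<integral>\<^sup>+y. f ((\<Sum>c\<in>?B. h c *\<^sub>R c) + y *\<^sub>R a) \<partial>lborel) \<partial>(\<Pi>\<^sub>M b\<in>?B. lborel))"
  proof (rule nn_integral_cong)
    fix h :: "'a \<Rightarrow> real"
    have "(\<integral>\<^sup>+y. f ((\<Sum>c\<in>?B. h c *\<^sub>R c) + y *\<^sub>R a) \<partial>lborel) =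
       (\<integral>\<^sup>+y. f ((\<Sum>c\<in>?B. h c *\<^sub>R c) + y *\<^sub>R a) \<partial>(distr lborel borel ((+) (h b))))"
      by (simp add: lborel_distr_plus)
    also have "\<dots> = (\<integral>\<^sup>+y. f ((\<Sum>c\<in>?B. h c *\<^sub>R c) + y *\<^sub>R a + h b *\<^sub>R a) \<partial>lborel)"
      by (subst nn_integral_distr) (auto simp: algebra_simps)
    finally show "(\<integral>\<^sup>+y. f ((\<Sum>c\<in>?B. h c *\<^sub>R c) + y *\<^sub>R a + h b *\<^sub>R a) \<partial>lborel) =
        (\<integral>\<^sup>+y. f ((\<Sum>c\<in>?B. h c *\<^sub>R c) + y *\<^sub>R a) \<partial>lborel)" ..
  qed
  also have "\<dots> = (\<integral>\<^sup>+x. f x \<partial>lborel)"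
    by (rule fub[symmetric]) simp
  finally show ?thesis .
qed

lemma measurable_matrix_vector_mult [measurable]:
  "(*v) A \<in> borel \<rightarrow>\<^sub>M borel" for A :: "real^'n^'m"
  by (intro borel_measurable_continuous_onI linear_continuous_on bounded_linear_intros)
     (simp add: matrix_vector_mul_bounded_linear)

text \<open>Induction over elementary matrices. Products are handled by multiplicativity of the
  determinant, a zero row contradicts the determinant condition, and the diagonal, swap and shear
  matrices are computed directly.\<close>

lemma nn_integral_lborel_linear:
  fixes f :: "real^'d \<Rightarrow> ennreal" and A :: "real^'d^'d"
  assumes "det A \<noteq> 0" and "f \<in> borel_measurable borel"
  shows "(\<integral>\<^sup>+x. f x \<partial>lborel) = ennreal \<bar>det A\<bar> * (\<integral>\<^sup>+x. f (A *v x) \<partial>lborel)"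
proof -
  have B: "Basis = range (\<lambda>i. axis i 1 :: real^'d)"
    by (auto simp: Basis_vec_def)
  \<comment> \<open>The quantifier over \<open>f\<close> is part of the induction predicate because
    in a product \<open>A ** C\<close> the hypothesis for \<open>C\<close> is applied to
    \<open>f\<close> composed with \<open>A\<close>.\<close>
  let ?P = "\<lambda>A::real^'d^'d. det A \<noteq> 0 \<longrightarrow> (\<forall>f\<in>borel_measurable borel.
     (\<integral>\<^sup>+x. f x \<partial>lborel) = ennreal \<bar>det A\<bar> * (\<integral>\<^sup>+x. f (A *v x) \<partial>lborel))"
  have "?P A"
  proof (rule induct_matrix_elementary_alt)
    fix A C :: "real^'d^'d"
    assume PA: "?P A" and PC: "?P C"
    show "?P (A ** C)"
    proof (intro impI ballI)
      assume "det (A ** C) \<noteq> 0"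
      then have nz: "det A \<noteq> 0" "det C \<noteq> 0" by (auto simp: det_mul)
      fix f :: "real^'d \<Rightarrow> ennreal" assume [measurable]: "f \<in> borel_measurable borel"
      have "(\<integral>\<^sup>+x. f x \<partial>lborel) = ennreal \<bar>det A\<bar> * (\<integral>\<^sup>+x. f (A *v x) \<partial>lborel)"
        by (rule PA[rule_format, OF nz(1)]) simp
      also have "(\<integral>\<^sup>+x. f (A *v x) \<partial>lborel) = ennreal \<bar>det C\<bar> * (\<integral>\<^sup>+x. f (A *v (C *v x)) \<partial>lborel)"
        by (rule PC[rule_format, OF nz(2), of "\<lambda>x. f (A *v x)"]) simp
      finally show "(\<integral>\<^sup>+x. f x \<partial>lborel) = ennreal \<bar>det (A ** C)\<bar> * (\<integral>\<^sup>+x. f ((A ** C) *v x) \<partial>lborel)"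
        by (simp add: det_mul abs_mult ennreal_mult matrix_vector_mul_assoc mult.assoc)
    qed
  next
    fix A :: "real^'d^'d" and i assume "row i A = 0"
    then show "?P A" using det_zero_row by blast
  next
    fix A :: "real^'d^'d" assume diag: "\<And>i j. i \<noteq> j \<Longrightarrow> A $ i $ j = 0"
    show "?P A"
    proof (intro impI ballI)
      assume nz: "det A \<noteq> 0"
      have detA: "det A = (\<Prod>i\<in>UNIV. A $ i $ i)" by (rule det_diagonal) (use diag in auto)
      \<comment> \<open>The affine scaling theorem takes its factors indexed by basis vectors; the
        quadratic form of \<open>A\<close> reads the diagonal entry off the vector
        \<open>axis i 1\<close>.\<close>
      define c where "c b = b \<bullet> (A *v b)" for b :: "real^'d"
      have cax: "c (axis i 1) = A $ i $ i" for i
        by (simp add: c_def inner_axis' matrix_vector_mult_basis column_def)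
      have dec: "(\<Sum>j\<in>Basis. (c j * (x \<bullet> j)) *\<^sub>R j) = A *v x" for x
      proof -
        have "(\<Sum>j\<in>Basis. (c j * (x \<bullet> j)) *\<^sub>R j) = (\<Sum>i\<in>UNIV. (A $ i $ i * x $ i) *\<^sub>R axis i 1)"
          unfolding B by (subst sum.reindex) (auto simp: inj_on_def axis_eq_axis cax inner_axis)
        also have "\<dots> = A *v x"
        proof (rule vec_eq_iff[THEN iffD2], rule allI)
          fix j
          have "(\<Sum>i\<in>UNIV. (A $ i $ i * x $ i) *\<^sub>R axis i (1::real)) $ j = A $ j $ j * x $ j"
            by (simp add: axis_def if_distrib cong: if_cong)
          also have "\<dots> = (\<Sum>i\<in>UNIV. if i = j then A $ j $ j * x $ j else 0)"
            by simp
          also have "\<dots> = (A *v x) $ j"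
            by (auto simp: matrix_vector_mult_def diag simp del: sum.delta intro!: sum.cong)
          finally show "(\<Sum>i\<in>UNIV. (A $ i $ i * x $ i) *\<^sub>R axis i (1::real)) $ j = (A *v x) $ j" .
        qed
        finally show ?thesis .
      qed
      have c0: "c j \<noteq> 0" if "j \<in> Basis" for j
        using that nz unfolding B by (auto simp: cax detA)
      have pc: "(\<Prod>j\<in>Basis. \<bar>c j\<bar>) = \<bar>det A\<bar>"
        unfolding B detA by (subst prod.reindex) (auto simp: inj_on_def axis_eq_axis cax abs_prod)
      fix f :: "real^'d \<Rightarrow> ennreal" assume [measurable]: "f \<in> borel_measurable borel"
      have "lborel = density (distr lborel borel ((*v) A)) (\<lambda>_. ennreal \<bar>det A\<bar>)"
        using lborel_affine_euclidean[of c 0, OF c0] by (simp add: dec pc)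
      then have "(\<integral>\<^sup>+x. f x \<partial>lborel) = (\<integral>\<^sup>+x. f x \<partial>density (distr lborel borel ((*v) A)) (\<lambda>_. ennreal \<bar>det A\<bar>))"
        by simp
      also have "\<dots> = ennreal \<bar>det A\<bar> * (\<integral>\<^sup>+x. f (A *v x) \<partial>lborel)"
        by (simp add: nn_integral_density nn_integral_distr nn_integral_cmult)
      finally show "(\<integral>\<^sup>+x. f x \<partial>lborel) = ennreal \<bar>det A\<bar> * (\<integral>\<^sup>+x. f (A *v x) \<partial>lborel)" .
    qed
  next
    fix m n :: 'd assume mn: "m \<noteq> n"
    let ?A = "\<chi> i j. mat 1 $ i $ Transposition.transpose m n j :: real^'d^'d"
    have d: "\<bar>det ?A\<bar> = 1"
      using det_permute_columns[of "Transposition.transpose m n" "mat 1 :: real^'d^'d"]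
      by (simp add: permutes_swap_id sign_swap_id mn)
    have mul: "?A *v x = (\<chi> i. x $ Transposition.transpose m n i)" for x
    proof (rule vec_eq_iff[THEN iffD2], rule allI)
      fix i
      have "(?A *v x) $ i = (\<Sum>j\<in>UNIV. if j = Transposition.transpose m n i then x $ j else 0)"
        unfolding matrix_vector_mult_def mat_def vec_lambda_beta by (rule sum.cong) auto
      then show "(?A *v x) $ i = (\<chi> i. x $ Transposition.transpose m n i) $ i" by simp
    qed
    show "?P ?A" unfolding d mul by (simp add: nn_integral_lborel_swap_coordinates)
  next
    fix m n :: 'd assume mn: "m \<noteq> n"
    let ?A = "\<chi> i j. of_bool (i = m \<and> j = n \<or> i = j) :: real^'d^'d"
    have d: "det ?A = 1"
    proof -
      have "?A = (\<chi> k. if k = m then row m (mat 1) + 1 *s row n (mat 1) else row k (mat 1))"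
        using mn by (auto simp: vec_eq_iff row_def mat_def)
      then show ?thesis using det_row_operation[OF mn, of "mat 1 :: real^'d^'d" 1] by simp
    qed
    have mul: "?A *v x = x + (x \<bullet> axis n 1) *\<^sub>R axis m 1" for x
    proof (rule vec_eq_iff[THEN iffD2], rule allI)
      fix i
      have "(?A *v x) $ i = (\<Sum>j\<in>UNIV. (if j = i then x $ j else 0) + (if j = n \<and> i = m then x $ j else 0))"
        unfolding matrix_vector_mult_def vec_lambda_beta by (rule sum.cong) (use mn in auto)
      also have "\<dots> = x $ i + (if i = m then x $ n else 0)"
        by (simp add: sum.distrib)
      finally show "(?A *v x) $ i = (x + (x \<bullet> axis n 1) *\<^sub>R axis m 1) $ i"
        by (simp add: inner_axis) (simp add: axis_def)
    qed
    show "?P ?A" unfolding d mul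
      using mn by (auto simp: nn_integral_lborel_shear axis_eq_axis)
  qed
  with assms show ?thesis by blast
qed

text \<open>Change of variables as an identity of measures, in which form it transfers to Bochner
  integrals of signed functions such as \<open>x $ i * x $ j\<close> times a Gaussian.\<close>

lemma lborel_linear_density:
  fixes A :: "real^'d^'d"
  assumes "det A \<noteq> 0"
  shows "lborel = density (distr lborel borel ((*v) A)) (\<lambda>_. ennreal \<bar>det A\<bar>)"
proof (rule measure_eqI)
  fix X :: "(real^'d) set" assume "X \<in> sets lborel"
  then have [measurable]: "X \<in> sets borel" by simp
  have "emeasure lborel X = (\<integral>\<^sup>+x. indicator X x \<partial>lborel)" by simp
  also have "\<dots> = ennreal \<bar>det A\<bar> * (\<integral>\<^sup>+x. indicator X (A *v x) \<partial>lborel)"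
    by (rule nn_integral_lborel_linear[OF assms]) measurable
  also have "\<dots> = emeasure (density (distr lborel borel ((*v) A)) (\<lambda>_. ennreal \<bar>det A\<bar>)) X"
    by (simp add: emeasure_density nn_integral_distr nn_integral_cmult del: nn_integral_indicator)
  finally show "emeasure lborel X = emeasure (density (distr lborel borel ((*v) A)) (\<lambda>_. ennreal \<bar>det A\<bar>)) X" .
qed simp

lemma has_bochner_integral_lborel_linear:
  fixes f :: "real^'d \<Rightarrow> real" and A :: "real^'d^'d"
  assumes A: "det A \<noteq> 0" and [measurable]: "f \<in> borel_measurable borel"
    and f: "has_bochner_integral lborel (\<lambda>x. f (A *v x)) I"
  shows "has_bochner_integral lborel f (\<bar>det A\<bar> * I)"
proof -
  have "has_bochner_integral (distr lborel borel ((*v) A)) (\<lambda>x. \<bar>det A\<bar> *\<^sub>R f x) (\<bar>det A\<bar> *\<^sub>R I)"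
    using f by (intro has_bochner_integral_distr has_bochner_integral_scaleR_right) auto
  then show ?thesis
    by (subst lborel_linear_density[OF A], intro has_bochner_integral_density) auto
qed

subsection \<open>Gaussian integrals\<close>

lemma matrix_inv_eqI:
  fixes A B :: "real^'d^'d"
  assumes "A ** B = mat 1"
  shows "matrix_inv A = B"
proof -
  have BA: "B ** A = mat 1"
    using assms matrix_left_right_inverse by blast
  have "\<exists>A'. A ** A' = mat 1 \<and> A' ** A = mat 1"
    using assms BA by blast
  then have "A ** matrix_inv A = mat 1"
    unfolding matrix_inv_def by (rule someI2_ex) blast
  then have "B ** (A ** matrix_inv A) = B" by simp
  then show ?thesis by (simp add: matrix_mul_assoc BA)
qed

lemma inner_vector_matrix_mult:
  fixes V :: "real^'n^'m"
  shows "x \<bullet> (z v* V) = (V *v x) \<bullet> z"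
  by (metis dot_lmul_matrix inner_commute)

lemma symmetric_matrix_inner_commute:
  fixes P :: "real^'d^'d"
  assumes "transpose P = P"
  shows "x \<bullet> (P *v y) = y \<bullet> (P *v x)"
proof -
  have "x \<bullet> (P *v y) = (transpose P *v x) \<bullet> y"
    by (simp add: dot_lmul_matrix)
  then show ?thesis using assms by (simp add: inner_commute)
qed

text \<open>Gram-Schmidt for the inner product \<open>x \<bullet> (P *v y)\<close>: the columns of
  \<open>V\<close> form an orthonormal basis for it. The family is built by induction on the set of
  column indices.\<close>

lemma pos_def_matrix_congruent_one:
  fixes P :: "real^'d^'d"
  assumes "pos_def_matrix P"
  obtains V :: "real^'d^'d" where "transpose V ** P ** V = mat 1"
proof -
  have sym: "x \<bullet> (P *v y) = y \<bullet> (P *v x)" for x y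
    using assms symmetric_matrix_inner_commute unfolding pos_def_matrix_def by blast
  have pos: "x \<bullet> (P *v x) > 0" if "x \<noteq> 0" for x
    using assms that unfolding pos_def_matrix_def by blast
  have "\<exists>v :: 'd \<Rightarrow> real^'d. \<forall>i\<in>F. \<forall>j\<in>F. v i \<bullet> (P *v v j) = of_bool (i = j)" if "finite F" for F
    using that
  proof (induction F rule: finite_induct)
    case (insert z F)
    then obtain v :: "'d \<Rightarrow> real^'d" where v: "\<And>i j. i \<in> F \<Longrightarrow> j \<in> F \<Longrightarrow> v i \<bullet> (P *v v j) = of_bool (i = j)"
      by blast
    \<comment> \<open>The index \<open>z\<close> is not in \<open>F\<close>, so fewer vectors than
      the dimension have been chosen and some \<open>w\<close> lies outside their span.\<close>
    have "dim (v ` F) \<le> card (v ` F)"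
      by (intro dim_le_card' finite_imageI insert.hyps)
    also have "\<dots> \<le> card F"
      by (intro card_image_le insert.hyps)
    also have "\<dots> < CARD('d)"
      using insert.hyps by (intro psubset_card_mono) auto
    finally have "dim (v ` F) \<noteq> DIM(real^'d)"
      by simp
    then have "span (v ` F) \<noteq> UNIV"
      using dim_eq_full by blast
    then obtain w where w: "w \<notin> span (v ` F)" by blast
    \<comment> \<open>Removing from \<open>w\<close> its P-orthogonal projection leaves a vector
      orthogonal to the family, and nonzero because \<open>w\<close> is outside the span. It only
      remains to normalize it.\<close>
    define w' where "w' = w - (\<Sum>i\<in>F. (v i \<bullet> (P *v w)) *\<^sub>R v i)"
    have "(\<Sum>i\<in>F. (v i \<bullet> (P *v w)) *\<^sub>R v i) \<in> span (v ` F)"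
      by (intro span_sum span_scale span_base) auto
    with w have "w' \<noteq> 0" unfolding w'_def by auto
    then have p: "w' \<bullet> (P *v w') > 0" by (rule pos)
    have orth: "v j \<bullet> (P *v w') = 0" if "j \<in> F" for j
    proof -
      have "v j \<bullet> (P *v w') = v j \<bullet> (P *v w) - (\<Sum>i\<in>F. (v i \<bullet> (P *v w)) * (v j \<bullet> (P *v v i)))"
        unfolding w'_def
        by (simp add: matrix_vector_mult_diff_distrib inner_diff_right linear_sum[OF matrix_vector_mul_linear]
            matrix_vector_mult_scaleR inner_sum_right)
      also have "(\<Sum>i\<in>F. (v i \<bullet> (P *v w)) * (v j \<bullet> (P *v v i))) = (\<Sum>i\<in>F. if i = j then v j \<bullet> (P *v w) else 0)"
        by (rule sum.cong) (use that v in auto)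
      finally show ?thesis using that insert.hyps by simp
    qed
    define u where "u = (1 / sqrt (w' \<bullet> (P *v w'))) *\<^sub>R w'"
    have uu: "u \<bullet> (P *v u) = 1"
      using p by (simp add: u_def matrix_vector_mult_scaleR)
    have vu: "v j \<bullet> (P *v u) = 0" "u \<bullet> (P *v v j) = 0" if "j \<in> F" for j
      using orth[OF that] sym[of u "v j"] by (simp_all add: u_def matrix_vector_mult_scaleR)
    show ?case
    proof (rule exI[of _ "v(z := u)"], intro ballI)
      fix i j assume "i \<in> insert z F" "j \<in> insert z F"
      then show "(v(z := u)) i \<bullet> (P *v (v(z := u)) j) = of_bool (i = j)"
        using insert.hyps uu vu v by auto
    qed
  qed simp
  from this[of UNIV] obtain v :: "'d \<Rightarrow> real^'d" where v: "\<And>i j. v i \<bullet> (P *v v j) = of_bool (i = j)"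
    by auto
  define V :: "real^'d^'d" where "V = (\<chi> a i. v i $ a)"
  have col: "V *v axis i 1 = v i" for i
    by (simp add: matrix_vector_mult_basis V_def column_def vec_eq_iff)
  have "(transpose V ** P ** V) $ i $ j = mat 1 $ i $ j" for i j
  proof -
    have "(transpose V ** P ** V) $ i $ j = axis i 1 \<bullet> ((transpose V ** P ** V) *v axis j 1)"
      by (simp add: inner_axis' matrix_vector_mult_basis column_def)
    also have "\<dots> = (V *v axis i 1) \<bullet> (P *v (V *v axis j 1))"
      by (simp flip: matrix_vector_mul_assoc add: inner_vector_matrix_mult)
    finally show ?thesis by (simp add: col v mat_def)
  qed
  then show ?thesis by (intro that[of V]) (simp add: vec_eq_iff)
qed

lemma has_bochner_integral_lborel_prod:
  fixes f :: "'d::finite \<Rightarrow> real \<Rightarrow> real"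
  assumes "\<And>i. has_bochner_integral lborel (f i) (I i)"
  shows "has_bochner_integral lborel (\<lambda>x::real^'d. \<Prod>i\<in>UNIV. f i (x $ i)) (\<Prod>i\<in>UNIV. I i)"
proof -
  interpret product_sigma_finite "\<lambda>_::real^'d. lborel :: real measure" ..
  have [measurable]: "f i \<in> borel_measurable borel" for i
    using assms[of i] borel_measurable_has_bochner_integral by fastforce
  \<comment> \<open>Lebesgue measure on vectors is a product over \<open>Basis\<close>, while the
    factors \<open>f i\<close> are indexed by coordinates; \<open>ix\<close> translates a basis
    vector back to its coordinate.\<close>
  define ix where "ix b = (THE i. b = axis i (1::real))" for b :: "real^'d"
  have ix: "ix (axis i 1) = i" for i by (auto simp: ix_def axis_eq_axis)
  have B: "Basis = range (\<lambda>i. axis i 1 :: real^'d)"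
    by (auto simp: Basis_vec_def)
  have pB: "(\<Prod>b\<in>Basis. g b) = (\<Prod>i\<in>UNIV. g (axis i 1))" for g :: "real^'d \<Rightarrow> real"
    unfolding B by (subst prod.reindex) (auto simp: inj_on_def axis_eq_axis)
  have int: "integrable lborel (f i)" "integral\<^sup>L lborel (f i) = I i" for i
    using assms[of i] by (auto simp: has_bochner_integral_iff)
  have "has_bochner_integral (\<Pi>\<^sub>M b\<in>Basis. lborel) (\<lambda>h. \<Prod>b\<in>Basis. f (ix b) (h b)) (\<Prod>i\<in>UNIV. I i)"
    unfolding has_bochner_integral_iff
  proof
    show "integrable (\<Pi>\<^sub>M b\<in>Basis. lborel) (\<lambda>h. \<Prod>b\<in>Basis. f (ix b) (h b))"
      by (rule product_integrable_prod) (auto simp: int)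
    have "integral\<^sup>L (\<Pi>\<^sub>M b\<in>Basis. lborel) (\<lambda>h. \<Prod>b\<in>Basis. f (ix b) (h b)) = (\<Prod>b\<in>Basis. I (ix b))"
      by (subst product_integral_prod) (auto simp: int)
    then show "integral\<^sup>L (\<Pi>\<^sub>M b\<in>Basis. lborel) (\<lambda>h. \<Prod>b\<in>Basis. f (ix b) (h b)) = (\<Prod>i\<in>UNIV. I i)"
      by (simp add: pB ix)
  qed
  moreover have "(\<Sum>b\<in>Basis. h b *\<^sub>R b) $ i = h (axis i 1)" for h :: "real^'d \<Rightarrow> real" and i
  proof -
    have "(\<Sum>b\<in>Basis. h b *\<^sub>R b) $ i = (\<Sum>b\<in>Basis. h b *\<^sub>R b) \<bullet> axis i 1"
      by (simp add: inner_axis)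
    then show ?thesis by simp
  qed
  ultimately show ?thesis
    by (subst lborel_eq, intro has_bochner_integral_distr) (auto simp: pB ix)
qed

lemma has_bochner_integral_gaussian_moments_real:
  shows "has_bochner_integral lborel (\<lambda>x::real. exp (- x\<^sup>2 / 2)) (sqrt (2 * pi))"
    and "has_bochner_integral lborel (\<lambda>x::real. x * exp (- x\<^sup>2 / 2)) 0"
    and "has_bochner_integral lborel (\<lambda>x::real. x * x * exp (- x\<^sup>2 / 2)) (sqrt (2 * pi))"
proof -
  have e: "exp (- x\<^sup>2 / 2) = sqrt (2 * pi) * std_normal_density x" for x
    by (simp add: std_normal_density_def)
  show "has_bochner_integral lborel (\<lambda>x::real. exp (- x\<^sup>2 / 2)) (sqrt (2 * pi))"
    using has_bochner_integral_mult_right[OF std_normal_moment_even[of 0], of "sqrt (2 * pi)"]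
    unfolding e by simp
  show "has_bochner_integral lborel (\<lambda>x::real. x * exp (- x\<^sup>2 / 2)) 0"
    using has_bochner_integral_mult_right[OF std_normal_moment_odd[of 0], of "sqrt (2 * pi)"]
    unfolding e by (simp add: mult_ac)
  show "has_bochner_integral lborel (\<lambda>x::real. x * x * exp (- x\<^sup>2 / 2)) (sqrt (2 * pi))"
    using has_bochner_integral_mult_right[OF std_normal_moment_even[of 1], of "sqrt (2 * pi)"]
    unfolding e by (simp add: mult_ac power2_eq_square)
qed

lemma exp_inner_self_eq_prod:
  fixes y :: "real^'d"
  shows "exp (- (y \<bullet> y) / 2) = (\<Prod>l\<in>UNIV. exp (- (y $ l)\<^sup>2 / 2))"
  by (simp add: inner_vec_def power2_eq_square sum_negf sum_divide_distrib flip: exp_sum)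

lemma has_bochner_integral_std_gaussian:
  shows "has_bochner_integral lborel (\<lambda>y::real^'d. exp (- (y \<bullet> y) / 2)) (sqrt (2 * pi) ^ CARD('d))"
    and "has_bochner_integral lborel (\<lambda>y::real^'d. y $ i * y $ j * exp (- (y \<bullet> y) / 2))
           (sqrt (2 * pi) ^ CARD('d) * of_bool (i = j))"
proof -
  show "has_bochner_integral lborel (\<lambda>y::real^'d. exp (- (y \<bullet> y) / 2)) (sqrt (2 * pi) ^ CARD('d))"
    unfolding exp_inner_self_eq_prod
    using has_bochner_integral_lborel_prod[OF has_bochner_integral_gaussian_moments_real(1)] by simp
  \<comment> \<open>Coordinate \<open>l\<close> receives one factor \<open>x\<close> for each of
    \<open>i\<close>, \<open>j\<close> that equals \<open>l\<close>. For \<open>i = j\<close> this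
    is a second moment; for distinct indices two first moments appear, and they vanish.\<close>
  let ?f = "\<lambda>l x. (if l = i then x else 1) * (if l = j then x else 1) * exp (- x\<^sup>2 / 2)"
  let ?I = "\<lambda>l. if l = i \<or> l = j then sqrt (2 * pi) * of_bool (i = j) else sqrt (2 * pi)"
  have "has_bochner_integral lborel (?f l) (?I l)" for l
    using has_bochner_integral_gaussian_moments_real by auto
  from has_bochner_integral_lborel_prod[of ?f ?I, OF this]
  have "has_bochner_integral lborel (\<lambda>y::real^'d. \<Prod>l\<in>UNIV. ?f l (y $ l)) (\<Prod>l\<in>UNIV. ?I l)" .
  moreover have "(\<Prod>l\<in>UNIV. ?f l (y $ l)) = y $ i * y $ j * exp (- (y \<bullet> y) / 2)" for y :: "real^'d"
    unfolding exp_inner_self_eq_prod prod.distrib by simp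
  moreover have "(\<Prod>l\<in>UNIV. ?I l) = sqrt (2 * pi) ^ CARD('d) * of_bool (i = j)"
    by (cases "i = j") (auto cong: if_cong)
  ultimately show "has_bochner_integral lborel (\<lambda>y::real^'d. y $ i * y $ j * exp (- (y \<bullet> y) / 2))
           (sqrt (2 * pi) ^ CARD('d) * of_bool (i = j))"
    by simp
qed

text \<open>The substitution \<open>x = V y\<close> with \<open>V\<close> from the congruence turns
  the quadratic form into \<open>y \<bullet> y\<close>. The Jacobian is
  \<open>det P powr (- 1 / 2)\<close> and the inverse of \<open>P\<close> is
  \<open>V ** transpose V\<close>, so everything follows from standard Gaussian moments.\<close>

lemma
  fixes P :: "real^'d^'d"
  assumes "pos_def_matrix P"
  shows pos_def_matrix_det_pos: "det P > 0"
    and pos_def_matrix_mult_inv: "P ** matrix_inv P = mat 1"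
    and pos_def_matrix_inv: "pos_def_matrix (matrix_inv P)"
    and has_bochner_integral_gaussian:
      "has_bochner_integral lborel (\<lambda>x. exp (- (x \<bullet> (P *v x)) / 2))
        ((2 * pi) powr (CARD('d) / 2) * det P powr (- 1 / 2))"
    and has_bochner_integral_gaussian_moment2:
      "has_bochner_integral lborel (\<lambda>x. x $ i * x $ j * exp (- (x \<bullet> (P *v x)) / 2))
        ((2 * pi) powr (CARD('d) / 2) * det P powr (- 1 / 2) * matrix_inv P $ i $ j)"
proof -
  obtain V :: "real^'d^'d" where V: "transpose V ** P ** V = mat 1"
    using pos_def_matrix_congruent_one[OF assms] .
  have d1: "(det V)\<^sup>2 * det P = 1"
    using arg_cong[OF V, of det] by (simp add: det_mul power2_eq_square algebra_simps)
  then have dV: "det V \<noteq> 0" by auto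
  show dP: "det P > 0"
    using d1 by (metis zero_less_mult_pos zero_less_one zero_less_power2 dV)
  have aV: "\<bar>det V\<bar> = det P powr (- 1 / 2)"
  proof -
    have "(det V)\<^sup>2 = 1 / det P" using d1 dP by (simp add: field_simps)
    then have "\<bar>det V\<bar> = sqrt (1 / det P)" by (metis real_sqrt_abs)
    also have "\<dots> = det P powr (- 1 / 2)"
      using dP by (simp add: real_sqrt_divide powr_minus_divide powr_half_sqrt)
    finally show ?thesis .
  qed
  \<comment> \<open>For square matrices a right inverse of \<open>transpose V\<close>, here
    \<open>P ** V\<close>, is also a left inverse.\<close>
  have "P ** V ** transpose V = mat 1"
    using V matrix_left_right_inverse[of "transpose V" "P ** V"] by (simp add: matrix_mul_assoc)
  then have PV: "P ** (V ** transpose V) = mat 1" by (simp add: matrix_mul_assoc)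
  then have inv: "matrix_inv P = V ** transpose V" by (rule matrix_inv_eqI)
  show "P ** matrix_inv P = mat 1" using PV inv by simp
  show "pos_def_matrix (matrix_inv P)"
    unfolding pos_def_matrix_def
  proof (intro conjI allI impI)
    show "transpose (matrix_inv P) = matrix_inv P"
      by (simp add: inv matrix_transpose_mul)
    fix x :: "real^'d" assume "x \<noteq> 0"
    have "x \<bullet> (matrix_inv P *v x) = (transpose V *v x) \<bullet> (transpose V *v x)"
      by (simp add: inv dot_lmul_matrix flip: matrix_vector_mul_assoc)
    moreover have "transpose V *v x \<noteq> 0"
    proof
      assume "transpose V *v x = 0"
      then have "P *v (V *v (transpose V *v x)) = 0" by simp
      then show False
        using PV \<open>x \<noteq> 0\<close> by (simp only: matrix_vector_mul_assoc) (simp add: matrix_mul_assoc)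
    qed
    ultimately show "x \<bullet> (matrix_inv P *v x) > 0" by simp
  qed
  have sq: "sqrt (2 * pi) ^ CARD('d) = (2 * pi) powr (CARD('d) / 2)"
    by (simp add: powr_half_sqrt[symmetric] powr_powr flip: powr_realpow)
  have quad: "(V *v y) \<bullet> (P *v (V *v y)) = y \<bullet> y" for y
  proof -
    have "(V *v y) \<bullet> (P *v (V *v y)) = y \<bullet> ((transpose V ** P ** V) *v y)"
      by (simp flip: matrix_vector_mul_assoc add: inner_vector_matrix_mult)
    then show ?thesis by (simp add: V)
  qed
  have meas [measurable]: "(\<lambda>x. exp (- (x \<bullet> (P *v x)) / 2)) \<in> borel_measurable borel"
    by measurable
  have "has_bochner_integral lborel (\<lambda>x. exp (- (x \<bullet> (P *v x)) / 2)) (\<bar>det V\<bar> * sqrt (2 * pi) ^ CARD('d))"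
    by (rule has_bochner_integral_lborel_linear[OF dV meas])
       (simp only: quad has_bochner_integral_std_gaussian)
  then show "has_bochner_integral lborel (\<lambda>x. exp (- (x \<bullet> (P *v x)) / 2))
        ((2 * pi) powr (CARD('d) / 2) * det P powr (- 1 / 2))"
    unfolding aV sq by (simp only: mult.commute)
  let ?c = "sqrt (2 * pi) ^ CARD('d)"
  \<comment> \<open>Entry \<open>i\<close> times entry \<open>j\<close> of \<open>V *v y\<close> is
    a double sum of coordinate products. Only \<open>a = b\<close> survives integration, leaving the
    entry of \<open>V ** transpose V\<close>.\<close>
  have "has_bochner_integral lborel
     (\<lambda>y::real^'d. \<Sum>a\<in>UNIV. \<Sum>b\<in>UNIV. V $ i $ a * V $ j $ b * (y $ a * y $ b * exp (- (y \<bullet> y) / 2)))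
     (\<Sum>a\<in>UNIV. \<Sum>b\<in>UNIV. V $ i $ a * V $ j $ b * (?c * of_bool (a = b)))"
    by (intro has_bochner_integral_sum has_bochner_integral_mult_right has_bochner_integral_std_gaussian)
  moreover have "(\<Sum>a\<in>UNIV. \<Sum>b\<in>UNIV. V $ i $ a * V $ j $ b * (y $ a * y $ b * exp (- (y \<bullet> y) / 2))) =
      (V *v y) $ i * (V *v y) $ j * exp (- ((V *v y) \<bullet> (P *v (V *v y))) / 2)" for y :: "real^'d"
  proof -
    have "(\<Sum>a\<in>UNIV. \<Sum>b\<in>UNIV. V $ i $ a * V $ j $ b * (y $ a * y $ b * exp (- (y \<bullet> y) / 2))) =
      (\<Sum>a\<in>UNIV. V $ i $ a * y $ a) * (\<Sum>b\<in>UNIV. V $ j $ b * y $ b) * exp (- (y \<bullet> y) / 2)"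
      by (subst sum_product) (simp add: sum_distrib_left sum_distrib_right mult_ac)
    then show ?thesis unfolding quad by (simp add: matrix_vector_mult_def)
  qed
  moreover have "(\<Sum>a\<in>UNIV. \<Sum>b\<in>UNIV. V $ i $ a * V $ j $ b * (?c * of_bool (a = b))) = ?c * matrix_inv P $ i $ j"
  proof -
    have "(\<Sum>b\<in>UNIV. V $ i $ a * V $ j $ b * (?c * of_bool (a = b))) = ?c * (V $ i $ a * V $ j $ a)" for a
    proof -
      have "(\<Sum>b\<in>UNIV. V $ i $ a * V $ j $ b * (?c * of_bool (a = b))) =
          (\<Sum>b\<in>UNIV. if b = a then ?c * (V $ i $ a * V $ j $ a) else 0)"
        by (rule sum.cong) auto
      then show ?thesis by simp
    qed
    then show ?thesis
      by (simp add: inv matrix_matrix_mult_def transpose_def sum_distrib_left)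
  qed
  ultimately have "has_bochner_integral lborel
     (\<lambda>y. (V *v y) $ i * (V *v y) $ j * exp (- ((V *v y) \<bullet> (P *v (V *v y))) / 2)) (?c * matrix_inv P $ i $ j)"
    by simp
  from has_bochner_integral_lborel_linear[OF dV _ this, unfolded aV sq]
  show "has_bochner_integral lborel (\<lambda>x. x $ i * x $ j * exp (- (x \<bullet> (P *v x)) / 2))
        ((2 * pi) powr (CARD('d) / 2) * det P powr (- 1 / 2) * matrix_inv P $ i $ j)"
    by (simp add: mult_ac)
qed

subsection \<open>Expected determinants of sums of outer products\<close>

text \<open>A Cauchy-Binet type expansion: in the Leibniz formula each row \<open>a\<close> selects
  a summand \<open>g a\<close>, and selections that repeat a vector cancel over the
  permutations.\<close>

lemma det_sum_outer:
  fixes x :: "'i \<Rightarrow> real^'d"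
  assumes "finite I"
  shows "det (\<Sum>i\<in>I. outer (x i) (x i)) =
    (\<Sum>g | g \<in> UNIV \<rightarrow>\<^sub>E I \<and> inj g. \<Sum>p | p permutes UNIV.
       of_int (sign p) * (\<Prod>a\<in>UNIV. x (g a) $ a * x (g a) $ p a))"
proof -
  let ?G = "UNIV \<rightarrow>\<^sub>E I :: ('d \<Rightarrow> 'i) set"
  let ?t = "\<lambda>g p. of_int (sign p) * (\<Prod>a\<in>UNIV. x (g a) $ a * x (g a) $ p a) :: real"
  have finG: "finite ?G" using assms by (intro finite_PiE) auto
  have "det (\<Sum>i\<in>I. outer (x i) (x i)) =
      (\<Sum>p | p permutes UNIV. of_int (sign p) * (\<Prod>a\<in>UNIV. \<Sum>i\<in>I. x i $ a * x i $ p a))"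
    by (simp add: det_def outer_def)
  also have "\<dots> = (\<Sum>p | p permutes UNIV. \<Sum>g\<in>?G. ?t g p)"
    using assms by (simp add: prod_sum_PiE sum_distrib_left)
  also have "\<dots> = (\<Sum>g\<in>?G. \<Sum>p | p permutes UNIV. ?t g p)"
    by (rule sum.swap)
  also have "\<dots> = (\<Sum>g\<in>{g. g \<in> ?G \<and> inj g}. \<Sum>p | p permutes UNIV. ?t g p)"
  proof (rule sum.mono_neutral_right[OF finG])
    show "\<forall>g\<in>?G - {g. g \<in> ?G \<and> inj g}. (\<Sum>p | p permutes UNIV. ?t g p) = 0"
    proof
      fix g assume "g \<in> ?G - {g. g \<in> ?G \<and> inj g}"
      \<comment> \<open>Rows \<open>a\<close> and \<open>b\<close> are multiples of the same vector,
        so pulling out the row factors leaves a determinant with two equal rows.\<close>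
      then obtain a b where ab: "a \<noteq> b" "g a = g b" by (auto simp: inj_def)
      have "(\<Sum>p | p permutes UNIV. ?t g p) = det (\<chi> a. x (g a) $ a *s x (g a))"
        by (simp add: det_def)
      also have "\<dots> = (\<Prod>a\<in>UNIV. x (g a) $ a) * det (\<chi> a. x (g a))"
        by (rule det_rows_mul)
      also have "det (\<chi> a. x (g a)) = 0"
        using ab by (intro det_identical_rows[OF ab(1)]) (simp add: row_def)
      finally show "(\<Sum>p | p permutes UNIV. ?t g p) = 0" by simp
    qed
  qed auto
  finally show ?thesis .
qed

text \<open>The injections are counted by the falling factorial of \<open>k\<close>;
  \<open>CARD('d) \<le> k\<close> lets the natural-number differences be read as real ones.\<close>

lemma card_inj_PiE:
  assumes "CARD('d::finite) \<le> k"
  shows "real (card {g. g \<in> (UNIV::'d set) \<rightarrow>\<^sub>E {..<k} \<and> inj g}) = fact CARD('d) * real (k choose CARD('d))"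
proof -
  have "real (card {g. g \<in> (UNIV::'d set) \<rightarrow>\<^sub>E {..<k} \<and> inj g}) = (\<Prod>i=0..<CARD('d). real (k - i))"
    using card_inj_on_subset_funcset[of "UNIV::'d set" "{..<k}" UNIV] by simp
  also have "\<dots> = (\<Prod>i=0..<CARD('d). real k - real i)"
    using assms by (intro prod.cong) (auto simp: of_nat_diff)
  also have "\<dots> = fact CARD('d) * (real k gchoose CARD('d))"
    by (simp add: gbinomial_mult_fact)
  finally show ?thesis by (simp add: binomial_gbinomial)
qed

text \<open>Separates, in a product over all sample indices, the extra factors at the indices hit by
  \<open>g\<close>, and reindexes them by the rows that select them.\<close>

lemma prod_if_range:
  fixes g :: "'d::finite \<Rightarrow> 'i" and F :: "'d \<Rightarrow> real"
  assumes "finite I" "inj g" "range g \<subseteq> I"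
  shows "(\<Prod>i\<in>I. if i \<in> range g then F (inv g i) * G i else G i) = (\<Prod>a\<in>UNIV. F a) * (\<Prod>i\<in>I. G i)"
proof -
  have "(\<Prod>i\<in>I. if i \<in> range g then F (inv g i) * G i else G i) =
      (\<Prod>i\<in>I. if i \<in> range g then F (inv g i) else 1) * (\<Prod>i\<in>I. G i)"
    by (subst prod.distrib[symmetric]) (rule prod.cong, auto)
  also have "(\<Prod>i\<in>I. if i \<in> range g then F (inv g i) else 1) = (\<Prod>i\<in>range g. F (inv g i))"
    using assms by (simp add: prod.If_cases Int_absorb1)
  also have "\<dots> = (\<Prod>a\<in>UNIV. F a)"
    using assms(2) by (simp add: prod.reindex)
  finally show ?thesis .
qed

text \<open>An injective selection uses each vector at most once, so the integral of its monomial
  factors over the product measure. Every selection then contributes \<open>det C * c ^ k\<close>,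
  and the prefactor counts selections. Here \<open>c\<close> is the mass of the weight
  \<open>w\<close>, and \<open>C\<close> is the second moment matrix relative to that mass.\<close>

lemma has_bochner_integral_det_sum_outer:
  fixes M :: "(real^'d) measure"
  assumes "sigma_finite_measure M" and k: "CARD('d) \<le> k"
    and w: "has_bochner_integral M w c"
    and C: "\<And>i j. has_bochner_integral M (\<lambda>x. x $ i * x $ j * w x) (c * C $ i $ j)"
  shows "has_bochner_integral (PiM {..<k} (\<lambda>_. M))
    (\<lambda>X. det (\<Sum>i<k. outer (X i) (X i)) * (\<Prod>i<k. w (X i)))
    (fact CARD('d) * real (k choose CARD('d)) * det C * c ^ k)"
proof -
  interpret product_sigma_finite "\<lambda>_::nat. M"
    by (rule product_sigma_finite.intro) (rule assms)
  let ?G = "{g. g \<in> (UNIV::'d set) \<rightarrow>\<^sub>E {..<k} \<and> inj g}"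
  have monomial: "has_bochner_integral (PiM {..<k} (\<lambda>_. M))
     (\<lambda>X. (\<Prod>a\<in>UNIV. X (g a) $ a * X (g a) $ p a) * (\<Prod>i<k. w (X i))) ((\<Prod>a\<in>UNIV. C $ a $ p a) * c ^ k)"
    if g: "g \<in> ?G" for g and p :: "'d \<Rightarrow> 'd"
  proof -
    have rg: "inj g" "range g \<subseteq> {..<k}" using g by (auto simp: PiE_def)
    \<comment> \<open>Vector \<open>i\<close>, when selected, is selected by the single row
      \<open>inv g i\<close>, which dictates its two coordinates; all other vectors carry only the
      weight.\<close>
    let ?h = "\<lambda>i x. if i \<in> range g then x $ inv g i * x $ p (inv g i) * w x else w x"
    let ?I = "\<lambda>i. if i \<in> range g then C $ inv g i $ p (inv g i) * c else c"
    have h: "has_bochner_integral M (?h i) (?I i)" for i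
      using w C by (simp add: mult.commute)
    then have hI: "integrable M (?h i)" "integral\<^sup>L M (?h i) = ?I i" for i
      unfolding has_bochner_integral_iff by blast+
    have "has_bochner_integral (PiM {..<k} (\<lambda>_. M)) (\<lambda>X. \<Prod>i<k. ?h i (X i)) (\<Prod>i<k. ?I i)"
      unfolding has_bochner_integral_iff hI(2)[symmetric]
      by (intro conjI product_integrable_prod product_integral_prod finite_lessThan hI(1))
    moreover have "(\<Prod>i<k. ?h i (X i)) = (\<Prod>a\<in>UNIV. X (g a) $ a * X (g a) $ p a) * (\<Prod>i<k. w (X i))" for X
    proof -
      have "(\<Prod>i<k. ?h i (X i)) = (\<Prod>i<k. if i \<in> range g then (\<lambda>a. X (g a) $ a * X (g a) $ p a) (inv g i) * w (X i) else w (X i))"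
        by (rule prod.cong) (auto simp: rg(1))
      also have "\<dots> = (\<Prod>a\<in>UNIV. X (g a) $ a * X (g a) $ p a) * (\<Prod>i<k. w (X i))"
        by (rule prod_if_range) (use rg in auto)
      finally show ?thesis .
    qed
    moreover have "(\<Prod>i<k. ?I i) = (\<Prod>a\<in>UNIV. C $ a $ p a) * c ^ k"
      using prod_if_range[of "{..<k}" g "\<lambda>a. C $ a $ p a" "\<lambda>_. c"] rg by simp
    ultimately show ?thesis by simp
  qed
  have "has_bochner_integral (PiM {..<k} (\<lambda>_. M))
     (\<lambda>X. \<Sum>g\<in>?G. \<Sum>p | p permutes UNIV. of_int (sign p) * ((\<Prod>a\<in>UNIV. X (g a) $ a * X (g a) $ p a) * (\<Prod>i<k. w (X i))))
     (\<Sum>g\<in>?G. \<Sum>p | p permutes UNIV. of_int (sign p) * ((\<Prod>a\<in>UNIV. C $ a $ p a) * c ^ k))"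
    by (intro has_bochner_integral_sum has_bochner_integral_mult_right monomial)
  moreover have "(\<Sum>g\<in>?G. \<Sum>p | p permutes UNIV. of_int (sign p) * ((\<Prod>a\<in>UNIV. C $ a $ p a) * c ^ k)) =
     fact CARD('d) * real (k choose CARD('d)) * det C * c ^ k"
    by (simp add: card_inj_PiE[OF k] det_def sum_distrib_left sum_distrib_right mult_ac)
  ultimately show ?thesis
    by (simp add: det_sum_outer sum_distrib_right mult.assoc)
qed

subsection \<open>Exponentially tilted Gaussian integrals\<close>

definition pos_semidef_matrix :: "real^'d^'d \<Rightarrow> bool" where
  "pos_semidef_matrix T \<longleftrightarrow> transpose T = T \<and> (\<forall>x. x \<bullet> (T *v x) \<ge> 0)"

lemma pos_def_matrix_add_semidef:
  "pos_def_matrix P \<Longrightarrow> pos_semidef_matrix T \<Longrightarrow> pos_def_matrix (P + T)"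
  unfolding pos_def_matrix_def pos_semidef_matrix_def
  by (auto simp: vec_eq_iff transpose_def matrix_vector_mult_add_rdistrib inner_add_right add_pos_nonneg)

lemma pos_semidef_matrix_add:
  "pos_semidef_matrix P \<Longrightarrow> pos_semidef_matrix T \<Longrightarrow> pos_semidef_matrix (P + T)"
  unfolding pos_semidef_matrix_def
  by (auto simp: vec_eq_iff transpose_def matrix_vector_mult_add_rdistrib inner_add_right)

lemma pos_semidef_matrix_0: "pos_semidef_matrix 0"
  by (simp add: pos_semidef_matrix_def vec_eq_iff transpose_def)

lemma outer_mult_vector: "outer x y *v z = (y \<bullet> z) *\<^sub>R x"
  by (simp add: outer_def matrix_vector_mult_def vec_eq_iff inner_vec_def sum_distrib_left sum_distrib_right mult_ac)

lemma inner_outer: "outer x x \<bullet> T = x \<bullet> (T *v x)"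
  by (simp add: outer_def matrix_vector_mult_def inner_vec_def sum_distrib_left mult_ac)

lemma pos_semidef_matrix_outer: "pos_semidef_matrix (outer x x)"
  unfolding pos_semidef_matrix_def
  by (simp add: outer_mult_vector inner_commute) (simp add: outer_def transpose_def vec_eq_iff)

lemma pos_semidef_matrix_sum_outer: "pos_semidef_matrix (\<Sum>i\<in>I. outer (x i) (x i))"
  by (induction I rule: infinite_finite_induct)
    (simp_all add: pos_semidef_matrix_0 pos_semidef_matrix_add pos_semidef_matrix_outer)

text \<open>A zero of the quadratic form is orthogonal to every \<open>x i\<close>, hence in the
  kernel. A nonsingular sum is therefore positive definite. This makes the volume sampling weight a
  genuine nonnegative density.\<close>

lemma det_sum_outer_nonneg:
  fixes x :: "'i \<Rightarrow> real^'d"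
  assumes "finite I"
  shows "det (\<Sum>i\<in>I. outer (x i) (x i)) \<ge> 0"
proof (cases "det (\<Sum>i\<in>I. outer (x i) (x i)) = 0")
  case False
  let ?A = "\<Sum>i\<in>I. outer (x i) (x i)"
  have mul: "?A *v y = (\<Sum>i\<in>I. (x i \<bullet> y) *\<^sub>R x i)" for y
    using assms by (induction I rule: finite_induct) (simp_all add: matrix_vector_mult_add_rdistrib outer_mult_vector)
  have "y \<bullet> (?A *v y) > 0" if "y \<noteq> 0" for y
  proof -
    have q: "y \<bullet> (?A *v y) = (\<Sum>i\<in>I. (x i \<bullet> y)\<^sup>2)"
      by (simp add: mul inner_sum_right power2_eq_square inner_commute)
    have "y \<bullet> (?A *v y) \<noteq> 0"
    proof
      assume "y \<bullet> (?A *v y) = 0"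
      then have "x i \<bullet> y = 0" if "i \<in> I" for i
        using that assms unfolding q by (simp add: sum_nonneg_eq_0_iff)
      then have "?A *v y = 0" by (simp add: mul)
      then show False
        using False that by (metis invertible_det_nz invertible_left_inverse matrix_left_invertible_ker)
    qed
    moreover have "y \<bullet> (?A *v y) \<ge> 0" unfolding q by (simp add: sum_nonneg)
    ultimately show ?thesis by simp
  qed
  then have "pos_def_matrix ?A"
    using pos_semidef_matrix_sum_outer[of x I] by (simp add: pos_def_matrix_def pos_semidef_matrix_def)
  then show ?thesis by (intro less_imp_le pos_def_matrix_det_pos)
qed simp

text \<open>The tilt adds \<open>x \<bullet> (T *v x)\<close> to a quadratic form carrying the
  factor 1/2, so the precision grows by \<open>T + T\<close>. Writing it as a sum lets closure of
  the cone under addition give positive definiteness of \<open>Q\<close>.\<close>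

lemma
  fixes S T :: "real^'d^'d"
  assumes S: "pos_def_matrix S" and T: "pos_semidef_matrix T"
  defines "Q \<equiv> matrix_inv S + (T + T)"
  shows has_bochner_integral_mvnormal_exp:
      "has_bochner_integral (mvnormal S) (\<lambda>x. exp (- (x \<bullet> (T *v x)))) ((det S * det Q) powr (- 1 / 2))"
    and has_bochner_integral_mvnormal_moment2_exp:
      "has_bochner_integral (mvnormal S) (\<lambda>x. x $ i * x $ j * exp (- (x \<bullet> (T *v x))))
        ((det S * det Q) powr (- 1 / 2) * matrix_inv Q $ i $ j)"
    and pos_def_matrix_tilted_precision: "pos_def_matrix Q"
proof -
  show Q: "pos_def_matrix Q"
    unfolding Q_def by (intro pos_def_matrix_add_semidef pos_def_matrix_inv pos_semidef_matrix_add S T)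
  have dS: "det S > 0" and dQ: "det Q > 0"
    using S Q pos_def_matrix_det_pos by auto
  let ?n = "(2 * pi) powr (- real CARD('d) / 2) * det S powr (- 1 / 2)"
  let ?m = "(2 * pi) powr (real CARD('d) / 2)"
  have tilt: "?n * exp (- (x \<bullet> (matrix_inv S *v x)) / 2) * (y * exp (- (x \<bullet> (T *v x))))
      = ?n * (y * exp (- (x \<bullet> (Q *v x)) / 2))" for x y
  proof -
    have "exp (- (x \<bullet> (Q *v x)) / 2) = exp (- (x \<bullet> (matrix_inv S *v x)) / 2) * exp (- (x \<bullet> (T *v x)))"
      unfolding Q_def matrix_vector_mult_add_rdistrib inner_add_right exp_add[symmetric]
      by (simp add: field_simps)
    then show ?thesis by simp
  qed
  \<comment> \<open>The normalizing power of \<open>2 * pi\<close> in the density cancels the one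
    from the Gaussian integral with precision \<open>Q\<close>.\<close>
  have cancel: "?n * (?m * det Q powr (- 1 / 2)) = (det S * det Q) powr (- 1 / 2)"
  proof -
    have one: "(2 * pi) powr (- real CARD('d) / 2) * ?m = 1"
      by (simp flip: powr_add)
    have "?n * (?m * det Q powr (- 1 / 2)) =
        ((2 * pi) powr (- real CARD('d) / 2) * ?m) * (det S powr (- 1 / 2) * det Q powr (- 1 / 2))"
      by (simp only: mult_ac)
    then show ?thesis using dS dQ unfolding one by (simp add: powr_mult)
  qed
  have *: "has_bochner_integral (mvnormal S) (\<lambda>x. f x * exp (- (x \<bullet> (T *v x)))) (?n * I)"
    if [measurable]: "f \<in> borel_measurable borel"
      and I: "has_bochner_integral lborel (\<lambda>x. f x * exp (- (x \<bullet> (Q *v x)) / 2)) I" for f I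
    unfolding mvnormal_def
  proof (rule has_bochner_integral_density)
    show "has_bochner_integral lborel (\<lambda>x. (?n * exp (- (x \<bullet> (matrix_inv S *v x)) / 2)) *\<^sub>R
        (f x * exp (- (x \<bullet> (T *v x))))) (?n * I)"
      unfolding real_scaleR_def tilt using I by (rule has_bochner_integral_mult_right)
  qed auto
  show "has_bochner_integral (mvnormal S) (\<lambda>x. exp (- (x \<bullet> (T *v x)))) ((det S * det Q) powr (- 1 / 2))"
    using *[of "\<lambda>_. 1", unfolded mult_1, OF _ has_bochner_integral_gaussian[OF Q]] unfolding cancel by simp
  show "has_bochner_integral (mvnormal S) (\<lambda>x. x $ i * x $ j * exp (- (x \<bullet> (T *v x))))
        ((det S * det Q) powr (- 1 / 2) * matrix_inv Q $ i $ j)"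
    using *[of "\<lambda>x. x $ i * x $ j", OF _ has_bochner_integral_gaussian_moment2[OF Q]]
    unfolding mult.assoc[of "_ * _" "det Q powr _"] mult.assoc[of ?n "_ * _", symmetric] cancel
    by simp
qed

subsection \<open>Uniqueness of Laplace transforms on positive semidefinite matrices\<close>

text \<open>Closed sets are an intersection-stable generator of the Borel sets, and the indicator of
  a nonempty closed set is the pointwise limit of the continuous functions
  \<open>max 0 (1 - real n * infdist x C)\<close>.\<close>

lemma finite_measure_eqI_continuous:
  fixes M N :: "'a::euclidean_space measure"
  assumes fin: "finite_measure M" "finite_measure N"
    and sets: "sets M = sets borel" "sets N = sets borel"
    and eq: "\<And>f. continuous_on UNIV f \<Longrightarrow> (\<And>x. 0 \<le> f x \<and> f x \<le> 1) \<Longrightarrow> integral\<^sup>L M f = (integral\<^sup>L N f :: real)"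
  shows "M = N"
proof -
  have lim: "(\<lambda>n. integral\<^sup>L L (\<lambda>x. max 0 (1 - real n * infdist x C))) \<longlonglongrightarrow> measure L C"
    if "finite_measure L" "sets L = sets borel" "closed C" "C \<noteq> {}" for L :: "'a measure" and C
  proof -
    interpret finite_measure L by fact
    have [measurable_cong]: "sets L = sets borel" by fact
    have [measurable]: "C \<in> sets borel" using that by simp
    have [measurable]: "(\<lambda>x. infdist x C) \<in> borel_measurable borel"
      by (intro borel_measurable_continuous_onI continuous_intros)
    have "(\<lambda>n. integral\<^sup>L L (\<lambda>x. max 0 (1 - real n * infdist x C))) \<longlonglongrightarrow> integral\<^sup>L L (indicator C)"
    proof (rule integral_dominated_convergence[where w = "\<lambda>_. 1"])
      show "AE x in L. (\<lambda>n. max 0 (1 - real n * infdist x C)) \<longlonglongrightarrow> indicator C x"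
      proof (rule AE_I2)
        fix x
        show "(\<lambda>n. max 0 (1 - real n * infdist x C)) \<longlonglongrightarrow> indicator C x"
        proof (cases "x \<in> C")
          case False
          then have d: "infdist x C > 0"
            using that in_closed_iff_infdist_zero[of C x] infdist_nonneg[of x C] by auto
          then obtain m where m: "real m * infdist x C > 1"
            using reals_Archimedean3 by blast
          have "\<forall>\<^sub>F n in sequentially. max 0 (1 - real n * infdist x C) = 0"
            using eventually_ge_at_top[of m]
          proof eventually_elim
            case (elim n)
            then have "real m * infdist x C \<le> real n * infdist x C" using d by (intro mult_right_mono) auto
            with m show ?case by simp
          qed
          then show ?thesis using False by (simp add: tendsto_eventually)
        qed simp
      qed
    qed (auto simp: infdist_nonneg)
    moreover have "integral\<^sup>L L (indicator C) = measure L C"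
      using that by simp
    ultimately show ?thesis by simp
  qed
  have meas: "measure M C = measure N C" if "closed C" for C
  \<comment> \<open>The empty set is separate because \<open>infdist x {}\<close> is 0 by
    convention, so the approximating functions would be constantly 1.\<close>
  proof (cases "C = {}")
    case False
    have "integral\<^sup>L M (\<lambda>x. max 0 (1 - real n * infdist x C)) = integral\<^sup>L N (\<lambda>x. max 0 (1 - real n * infdist x C))" for n
      by (intro eq continuous_intros) (auto simp: infdist_nonneg)
    then show ?thesis
      using lim[OF fin(1) sets(1) that False] lim[OF fin(2) sets(2) that False]
      by (simp add: LIMSEQ_unique)
  qed simp
  interpret M: finite_measure M by fact
  interpret N: finite_measure N by fact
  show ?thesis
  proof (rule measure_eqI_generator_eq[where E = "Collect closed" and \<Omega> = UNIV and A = "\<lambda>_. UNIV"])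
    show "Int_stable (Collect closed :: 'a set set)" by (auto simp: Int_stable_def)
    show "sets M = sigma_sets UNIV (Collect closed)" "sets N = sigma_sets UNIV (Collect closed)"
      by (simp_all add: sets borel_eq_closed)
    show "emeasure M X = emeasure N X" if "X \<in> Collect closed" for X
      using meas[of X] that by (simp add: M.emeasure_eq_measure N.emeasure_eq_measure)
  qed auto
qed

text \<open>By Stone-Weierstrass a continuous test function is within \<open>e\<close> of a
  polynomial on \<open>K\<close>. Both measures live on \<open>K\<close>, so the two integrals
  differ by at most \<open>e\<close> times the total masses, for every positive
  \<open>e\<close>.\<close>

lemma finite_measure_eqI_polynomial_moments:
  fixes M N :: "'a::euclidean_space measure"
  assumes fin: "finite_measure M" "finite_measure N"
    and sets: "sets M = sets borel" "sets N = sets borel"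
    and K: "compact K" "AE x in M. x \<in> K" "AE x in N. x \<in> K"
    and eq: "\<And>p. real_polynomial_function p \<Longrightarrow> integral\<^sup>L M p = integral\<^sup>L N p"
  shows "M = N"
proof (rule finite_measure_eqI_continuous[OF fin sets])
  fix f :: "'a \<Rightarrow> real"
  assume cont: "continuous_on UNIV f" and f01: "\<And>x. 0 \<le> f x \<and> f x \<le> 1"
  have approx: "\<bar>integral\<^sup>L L f - integral\<^sup>L L p\<bar> \<le> e * measure L (space L)"
    if L: "finite_measure L" "sets L = sets borel" "AE x in L. x \<in> K"
      and p: "real_polynomial_function p" "\<And>x. x \<in> K \<Longrightarrow> \<bar>f x - p x\<bar> < e" for L p e
  proof -
    interpret finite_measure L by fact
    have [measurable_cong]: "sets L = sets borel" by fact
    have [measurable]: "f \<in> borel_measurable borel" "p \<in> borel_measurable borel"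
      using cont p(1) by (auto intro!: borel_measurable_continuous_onI continuous_on_polymonial_function
        simp: real_polynomial_function_eq)
    have intf: "integrable L f"
      using f01 by (intro integrable_const_bound[of _ 1]) (auto simp: abs_le_iff intro: order_trans[of _ 0])
    have intp: "integrable L p"
    \<comment> \<open>The polynomial may be unbounded, but almost everywhere the point lies in
      \<open>K\<close>, where it stays within \<open>e\<close> of a function with values in
      [0, 1].\<close>
    proof (rule integrable_const_bound[of _ "1 + e"])
      show "AE x in L. norm (p x) \<le> 1 + e"
        using L(3)
      proof eventually_elim
        case (elim x)
        show ?case using p(2)[OF elim] f01[of x] by auto
      qed
    qed simp
    have "\<bar>integral\<^sup>L L f - integral\<^sup>L L p\<bar> = \<bar>integral\<^sup>L L (\<lambda>x. f x - p x)\<bar>"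
      using intf intp by simp
    also have "\<dots> \<le> integral\<^sup>L L (\<lambda>x. \<bar>f x - p x\<bar>)"
      by (rule integral_abs_bound)
    also have "\<dots> \<le> integral\<^sup>L L (\<lambda>x. e)"
    proof (rule integral_mono_AE)
      show "AE x in L. \<bar>f x - p x\<bar> \<le> e"
        using L(3) by eventually_elim (use p(2) in \<open>auto intro: less_imp_le\<close>)
    qed (use intf intp in auto)
    finally show ?thesis by (simp add: mult.commute)
  qed
  let ?c = "measure M (space M) + measure N (space N)"
  have bound: "\<bar>integral\<^sup>L M f - integral\<^sup>L N f\<bar> \<le> e * ?c" if e: "e > 0" for e
  proof -
    obtain p where p: "real_polynomial_function p" "\<And>x. x \<in> K \<Longrightarrow> \<bar>f x - p x\<bar> < e"
      using Stone_Weierstrass_real_polynomial_function[OF K(1) continuous_on_subset[OF cont subset_UNIV] e] by auto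
    show ?thesis
      using approx[OF fin(1) sets(1) K(2) p] approx[OF fin(2) sets(2) K(3) p] eq[OF p(1)]
      by (simp add: algebra_simps)
  qed
  have "((\<lambda>e. e * ?c) \<longlongrightarrow> 0 * ?c) (at_right 0)"
    by (intro tendsto_intros)
  moreover have "\<forall>\<^sub>F e in at_right 0. \<bar>integral\<^sup>L M f - integral\<^sup>L N f\<bar> \<le> e * ?c"
    using bound by (auto simp: eventually_at_right_field intro!: exI[of _ 1])
  ultimately have "\<bar>integral\<^sup>L M f - integral\<^sup>L N f\<bar> \<le> 0 * ?c"
    by (rule tendsto_lowerbound) simp
  then show "integral\<^sup>L M f = integral\<^sup>L N f" by simp
qed

text \<open>The linear span of the Laplace kernels: equality of transforms extends to it by
  linearity. Taking \<open>T = 0\<close> shows that it contains the constants.\<close>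

inductive exp_polynomial :: "(real^'d^'d \<Rightarrow> real) \<Rightarrow> bool" where
  exp: "pos_semidef_matrix T \<Longrightarrow> exp_polynomial (\<lambda>A. exp (- (A \<bullet> T)))"
| scale: "exp_polynomial f \<Longrightarrow> exp_polynomial (\<lambda>A. c * f A)"
| add: "exp_polynomial f \<Longrightarrow> exp_polynomial g \<Longrightarrow> exp_polynomial (\<lambda>A. f A + g A)"

lemma exp_polynomial_const: "exp_polynomial (\<lambda>A. c)"
  using exp_polynomial.scale[OF exp_polynomial.exp[OF pos_semidef_matrix_0], of c] by simp

lemma exp_polynomial_sum:
  "(\<And>i. i \<in> I \<Longrightarrow> exp_polynomial (f i)) \<Longrightarrow> exp_polynomial (\<lambda>A. \<Sum>i\<in>I. f i A)"
  by (induction I rule: infinite_finite_induct) (auto intro: exp_polynomial_const exp_polynomial.add)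

text \<open>By bilinearity two kernels suffice, and their product is the kernel of the sum of their
  parameters.\<close>

lemma exp_polynomial_mult:
  assumes "exp_polynomial f" "exp_polynomial g"
  shows "exp_polynomial (\<lambda>A. f A * g A)"
  using assms
proof (induction f rule: exp_polynomial.induct)
  case (exp T)
  show ?case
    using exp.prems
  proof (induction g rule: exp_polynomial.induct)
    case (exp T')
    have "exp_polynomial (\<lambda>A. exp (- (A \<bullet> (T + T'))))"
      using exp \<open>pos_semidef_matrix T\<close> by (intro exp_polynomial.exp pos_semidef_matrix_add)
    then show ?case by (simp add: inner_add_right flip: exp_add)
  next
    case (scale g c)
    from exp_polynomial.scale[OF scale.IH, of c] show ?case by (simp add: mult_ac)
  next
    case (add g h)
    from exp_polynomial.add[OF add.IH] show ?case by (simp add: algebra_simps)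
  qed
next
  case (scale f c)
  from exp_polynomial.scale[OF scale.IH[OF scale.prems], of c] show ?case by (simp add: mult_ac)
next
  case (add f h)
  from exp_polynomial.add[OF add.IH(1)[OF add.prems] add.IH(2)[OF add.prems]]
  show ?case by (simp add: algebra_simps)
qed

text \<open>The embedding maps the positive semidefinite matrices into a compact cube. There polynomials
  determine a finite measure, and polynomials in the embedded coordinates are
  linear combinations of Laplace kernels.\<close>

definition exp_embedding :: "real^'d^'d \<Rightarrow> real^'d^'d" where
  "exp_embedding A = (\<chi> i j. exp (- (A \<bullet> outer (axis i 1 + axis j 1) (axis i 1 + axis j 1))))"

text \<open>Polarization: the exponent at $(i,j)$ is $A_{ii} + A_{jj} + 2A_{ij}$, which is $4A_{ii}$ for $i = j$.\<close>

definition log_recovery :: "real^'d^'d \<Rightarrow> real^'d^'d" where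
  "log_recovery u = (\<chi> i j. (ln (u $ i $ i) / 4 + ln (u $ j $ j) / 4 - ln (u $ i $ j)) / 2)"

lemma log_recovery_exp_embedding:
  assumes "transpose A = A"
  shows "log_recovery (exp_embedding A) = A"
proof -
  have sym: "A $ i $ j = A $ j $ i" for i j
    using assms by (metis transpose_def vec_lambda_beta)
  have "A \<bullet> outer (axis i 1 + axis j 1) (axis i 1 + axis j 1) = A $ i $ i + A $ j $ j + 2 * A $ i $ j" for i j
  proof -
    have "A \<bullet> outer (axis i 1 + axis j 1) (axis i 1 + axis j 1) =
        (axis i 1 + axis j 1) \<bullet> (A *v (axis i 1 + axis j 1))"
      by (simp add: inner_commute[of A] inner_outer)
    also have "\<dots> = A $ i $ i + A $ j $ j + 2 * A $ i $ j"
      by (simp add: inner_add_left matrix_vector_right_distrib matrix_vector_mult_basis inner_axis' column_def sym[of j i])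
    finally show ?thesis .
  qed
  then show ?thesis
    by (simp add: log_recovery_def exp_embedding_def vec_eq_iff)
qed

text \<open>Each coordinate of the embedding is a kernel with a rank-one parameter, and the span of
  kernels is an algebra containing the constants.\<close>

lemma exp_polynomial_exp_embedding:
  assumes "real_polynomial_function p"
  shows "exp_polynomial (\<lambda>A. p (exp_embedding A))"
  using assms
proof (induction p rule: real_polynomial_function.induct)
  case (linear f)
  interpret bounded_linear f by fact
  have "exp_polynomial (\<lambda>A. \<Sum>b\<in>Basis. f b * (exp_embedding A \<bullet> b))"
  proof (intro exp_polynomial_sum exp_polynomial.scale)
    fix b :: "real^'a^'a" assume "b \<in> Basis"
    then obtain i j where b: "b = axis i (axis j 1)" by (auto simp: Basis_vec_def)
    show "exp_polynomial (\<lambda>A. exp_embedding A \<bullet> b)"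
      unfolding b by (simp add: inner_axis exp_embedding_def exp_polynomial.exp pos_semidef_matrix_outer)
  qed
  moreover have "f (exp_embedding A) = (\<Sum>b\<in>Basis. f b * (exp_embedding A \<bullet> b))" for A
    by (subst (1) euclidean_representation[symmetric]) (simp only: sum scaleR real_scaleR_def mult.commute)
  ultimately show ?case by simp
qed (auto intro: exp_polynomial_const exp_polynomial.add exp_polynomial_mult)

lemma borel_measurable_vec_nth [measurable]: "(\<lambda>x. x $ i) \<in> borel \<rightarrow>\<^sub>M borel"
  for i :: "'n::finite"
  by (intro borel_measurable_continuous_onI continuous_intros)

lemma borel_measurable_matrix_lambda:
  fixes f :: "'a \<Rightarrow> 'n::finite \<Rightarrow> 'm::finite \<Rightarrow> real"
  assumes "\<And>i j. (\<lambda>x. f x i j) \<in> borel_measurable M"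
  shows "(\<lambda>x. \<chi> i j. f x i j) \<in> borel_measurable M"
proof (subst borel_measurable_euclidean_space, rule ballI)
  fix b :: "real^'m^'n" assume "b \<in> Basis"
  then obtain i j where "b = axis i (axis j 1)" by (auto simp: Basis_vec_def)
  then show "(\<lambda>x. (\<chi> i j. f x i j) \<bullet> b) \<in> borel_measurable M"
    using assms by (simp add: inner_axis)
qed

lemma measurable_exp_embedding [measurable]: "exp_embedding \<in> borel \<rightarrow>\<^sub>M borel"
  unfolding exp_embedding_def by (intro borel_measurable_matrix_lambda) measurable

lemma measurable_log_recovery [measurable]: "log_recovery \<in> borel \<rightarrow>\<^sub>M borel"
  unfolding log_recovery_def by (intro borel_measurable_matrix_lambda) measurable

text \<open>Equality is proved for the images under \<open>exp_embedding\<close>, which have compact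
  support, and is then carried back by the measurable map \<open>log_recovery\<close>.\<close>

lemma distr_eqI_laplace_transform:
  fixes F :: "'a \<Rightarrow> real^'d^'d" and G :: "'b \<Rightarrow> real^'d^'d"
  assumes [measurable]: "F \<in> M \<rightarrow>\<^sub>M borel" "G \<in> N \<rightarrow>\<^sub>M borel"
    and psd: "\<And>x. pos_semidef_matrix (F x)" "\<And>x. pos_semidef_matrix (G x)"
    and LM: "\<And>T. pos_semidef_matrix T \<Longrightarrow> has_bochner_integral M (\<lambda>x. exp (- (F x \<bullet> T))) (L T)"
    and LN: "\<And>T. pos_semidef_matrix T \<Longrightarrow> has_bochner_integral N (\<lambda>x. exp (- (G x \<bullet> T))) (L T)"
  shows "distr M borel F = distr N borel G"
proof -
  \<comment> \<open>At the parameter 0 the kernel is constantly 1, so its integrability bounds the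
    total mass.\<close>
  have fin: "finite_measure L'" if "has_bochner_integral L' (\<lambda>x. exp (- (H x \<bullet> (0::real^'d^'d)))) c"
    for L' :: "'c measure" and H c
  proof
    have "integrable L' (\<lambda>_. 1::real)" using that by (simp add: has_bochner_integral_iff)
    then show "emeasure L' (space L') \<noteq> \<infinity>" by (simp add: integrable_iff_bounded)
  qed
  have finM: "finite_measure M" and finN: "finite_measure N"
    using fin[OF LM] fin[OF LN] pos_semidef_matrix_0 by auto
  have poly: "\<exists>c. has_bochner_integral M (\<lambda>x. q (F x)) c \<and> has_bochner_integral N (\<lambda>x. q (G x)) c"
    if "exp_polynomial q" for q
    using that
  proof (induction q rule: exp_polynomial.induct)
    case (exp T)
    then show ?case using LM LN by blast
  next
    case (scale f c)
    then obtain I where "has_bochner_integral M (\<lambda>x. f (F x)) I" "has_bochner_integral N (\<lambda>x. f (G x)) I"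
      by blast
    then show ?case
      by (intro exI[of _ "c * I"] conjI has_bochner_integral_mult_right)
  next
    case (add f g)
    then obtain I J where "has_bochner_integral M (\<lambda>x. f (F x)) I" "has_bochner_integral N (\<lambda>x. f (G x)) I"
      "has_bochner_integral M (\<lambda>x. g (F x)) J" "has_bochner_integral N (\<lambda>x. g (G x)) J"
      by blast
    then show ?case
      by (intro exI[of _ "I + J"] conjI has_bochner_integral_add)
  qed
  let ?FE = "\<lambda>x. exp_embedding (F x)" and ?GE = "\<lambda>x. exp_embedding (G x)"
  \<comment> \<open>On the cone every exponent \<open>- (A \<bullet> outer v v)\<close> is
    nonpositive, so all entries lie between 0 and 1.\<close>
  have box: "exp_embedding A \<in> cbox 0 One" if "pos_semidef_matrix A" for A :: "real^'d^'d"
    unfolding mem_box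
  proof
    fix b :: "real^'d^'d" assume b: "b \<in> Basis"
    then obtain i j where bij: "b = axis i (axis j 1)" by (auto simp: Basis_vec_def)
    have "A \<bullet> outer v v \<ge> 0" for v
      using that by (simp add: inner_commute[of A] inner_outer pos_semidef_matrix_def)
    then show "0 \<bullet> b \<le> exp_embedding A \<bullet> b \<and> exp_embedding A \<bullet> b \<le> One \<bullet> b"
      using b by (simp add: inner_Basis_inf_left inner_sum_Basis) (simp add: bij inner_axis exp_embedding_def)
  qed
  have "distr M borel ?FE = distr N borel ?GE"
  proof (rule finite_measure_eqI_polynomial_moments)
    show "finite_measure (distr M borel ?FE)" "finite_measure (distr N borel ?GE)"
      using finM finN by (auto intro!: finite_measure.finite_measure_distr)
    show "compact (cbox 0 One :: (real^'d^'d) set)" by simp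
    show "AE x in distr M borel ?FE. x \<in> cbox 0 One" "AE x in distr N borel ?GE. x \<in> cbox 0 One"
      using box psd by (simp_all add: AE_distr_iff)
    fix p :: "real^'d^'d \<Rightarrow> real" assume p: "real_polynomial_function p"
    then have [measurable]: "p \<in> borel_measurable borel"
      by (auto intro!: borel_measurable_continuous_onI continuous_on_polymonial_function
        simp: real_polynomial_function_eq)
    from poly[OF exp_polynomial_exp_embedding[OF p]]
    show "integral\<^sup>L (distr M borel ?FE) p = integral\<^sup>L (distr N borel ?GE) p"
      by (auto simp: integral_distr has_bochner_integral_iff)
  qed simp_all
  \<comment> \<open>\<open>log_recovery\<close> inverts the embedding on symmetric matrices only;
    the values of \<open>F\<close> and \<open>G\<close> are symmetric.\<close>
  then have "distr (distr M borel ?FE) borel log_recovery = distr (distr N borel ?GE) borel log_recovery"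
    by simp
  then show ?thesis
    using psd by (simp add: distr_distr comp_def pos_semidef_matrix_def log_recovery_exp_embedding)
qed

subsection \<open>Laplace transforms of Wishart and volume sampling\<close>

lemma sets_mvnormal [measurable_cong]: "sets (mvnormal S) = sets borel"
  by (simp add: mvnormal_def)

lemma sigma_finite_mvnormal:
  assumes "pos_def_matrix S"
  shows "sigma_finite_measure (mvnormal S)"
proof -
  have "integrable (mvnormal S) (\<lambda>_. 1::real)"
    using has_bochner_integral_mvnormal_exp[OF assms pos_semidef_matrix_0]
    by (simp add: has_bochner_integral_iff)
  then have "finite_measure (mvnormal S)"
    by (intro finite_measureI) (simp add: integrable_iff_bounded)
  then show ?thesis by (rule finite_measure.axioms)
qed

lemma measurable_sum_outer:
  "(\<lambda>X. \<Sum>i<k. outer (X i) (X i)) \<in> PiM {..<k} (\<lambda>_. mvnormal S) \<rightarrow>\<^sub>M borel"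
proof (intro borel_measurable_sum)
  fix i assume "i \<in> {..<k}"
  then have [measurable]: "(\<lambda>X. X i) \<in> PiM {..<k} (\<lambda>_. mvnormal S) \<rightarrow>\<^sub>M borel"
    using measurable_component_singleton[of i "{..<k}" "\<lambda>_. mvnormal S"]
    by (simp add: measurable_cong_sets[OF refl sets_mvnormal])
  show "(\<lambda>X. outer (X i) (X i)) \<in> borel_measurable (PiM {..<k} (\<lambda>_. mvnormal S))"
    unfolding outer_def by (intro borel_measurable_matrix_lambda) measurable
qed

lemma exp_inner_sum_outer:
  "exp (- ((\<Sum>i<k. outer (X i) (X i)) \<bullet> T)) = (\<Prod>i<k. exp (- (X i \<bullet> (T *v X i))))" for k :: nat
  unfolding inner_sum_left inner_outer sum_negf[symmetric] by (rule exp_sum) simp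

lemma has_bochner_integral_wishart_laplace:
  fixes S T :: "real^'d^'d"
  assumes S: "pos_def_matrix S" and T: "pos_semidef_matrix T"
  shows "has_bochner_integral (PiM {..<m} (\<lambda>_. mvnormal S)) (\<lambda>X. exp (- ((\<Sum>i<m. outer (X i) (X i)) \<bullet> T)))
    (((det S * det (matrix_inv S + (T + T))) powr (- 1 / 2)) ^ m)"
proof -
  interpret product_sigma_finite "\<lambda>_::nat. mvnormal S"
    by (rule product_sigma_finite.intro) (rule sigma_finite_mvnormal[OF S])
  note h = has_bochner_integral_mvnormal_exp[OF S T, unfolded has_bochner_integral_iff]
  show ?thesis
    unfolding exp_inner_sum_outer has_bochner_integral_iff
    using product_integrable_prod[of "{..<m}" "\<lambda>_ x. exp (- (x \<bullet> (T *v x)))"]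
      product_integral_prod[of "{..<m}" "\<lambda>_ x. exp (- (x \<bullet> (T *v x)))"] h
    by simp
qed

text \<open>The untilted case \<open>T = 0\<close> of the moment formula: the precision is
  \<open>matrix_inv S\<close>, so the mass is 1 and inverting twice returns
  \<open>S\<close>.\<close>

lemma second_moment_mvnormal:
  assumes "pos_def_matrix S"
  shows "second_moment (mvnormal S) = S"
proof -
  have "det S * det (matrix_inv S) = 1"
    using arg_cong[OF pos_def_matrix_mult_inv[OF assms], of det] by (simp add: det_mul)
  moreover have "matrix_inv (matrix_inv S) = S"
    using pos_def_matrix_mult_inv[OF assms] matrix_left_right_inverse by (intro matrix_inv_eqI) blast
  ultimately have "has_bochner_integral (mvnormal S) (\<lambda>x. x $ i * x $ j) (S $ i $ j)" for i j
    using has_bochner_integral_mvnormal_moment2_exp[OF assms pos_semidef_matrix_0, of i j] by simp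
  then show ?thesis
    by (simp add: second_moment_def vec_eq_iff has_bochner_integral_iff)
qed

text \<open>Instance of the expected determinant with weight
  \<open>exp (- (x \<bullet> (T *v x)))\<close>, mass \<open>?r\<close> and relative second moment
  \<open>matrix_inv ?Q\<close>. The combinatorial constant cancels against the normalization of the
  sampling density.\<close>

lemma has_bochner_integral_volume_sampling_laplace:
  fixes S T :: "real^'d^'d"
  assumes S: "pos_def_matrix S" and T: "pos_semidef_matrix T" and k: "k \<ge> CARD('d)"
  shows "has_bochner_integral (volume_sampling k (mvnormal S)) (\<lambda>X. exp (- ((\<Sum>i<k. outer (X i) (X i)) \<bullet> T)))
    (((det S * det (matrix_inv S + (T + T))) powr (- 1 / 2)) ^ (k + 2))"
proof -
  let ?Q = "matrix_inv S + (T + T)"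
  let ?r = "(det S * det ?Q) powr (- 1 / 2)"
  let ?c = "fact CARD('d) * real (k choose CARD('d))"
  have Q: "pos_def_matrix ?Q" by (rule pos_def_matrix_tilted_precision[OF S T])
  have dS: "det S > 0" and dQ: "det ?Q > 0"
    using S Q pos_def_matrix_det_pos by auto
  \<comment> \<open>This square is what the determinant ratio becomes; it raises the exponent from
    \<open>k\<close> to \<open>k + 2\<close>.\<close>
  have r2: "?r ^ 2 = 1 / (det S * det ?Q)"
    using dS dQ by (simp add: power2_eq_square powr_minus_divide flip: powr_add)
  have diQ: "det (matrix_inv ?Q) = 1 / det ?Q"
    using arg_cong[OF pos_def_matrix_mult_inv[OF Q], of det] dQ by (simp add: det_mul field_simps)
  have c: "?c > 0" using k by (simp add: zero_less_binomial_iff)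
  have meas [measurable]: "(\<lambda>X. \<Sum>i<k. outer (X i) (X i)) \<in> PiM {..<k} (\<lambda>_. mvnormal S) \<rightarrow>\<^sub>M borel"
    by (rule measurable_sum_outer)
  have [measurable]: "(det :: real^'d^'d \<Rightarrow> real) \<in> borel_measurable borel"
    unfolding det_def[abs_def] by measurable
  have "has_bochner_integral (PiM {..<k} (\<lambda>_. mvnormal S))
      (\<lambda>X. 1 / (?c * det S) * (det (\<Sum>i<k. outer (X i) (X i)) * (\<Prod>i<k. exp (- (X i \<bullet> (T *v X i))))))
      (1 / (?c * det S) * (?c * det (matrix_inv ?Q) * ?r ^ k))"
    by (intro has_bochner_integral_mult_right has_bochner_integral_det_sum_outer sigma_finite_mvnormal S k
        has_bochner_integral_mvnormal_exp has_bochner_integral_mvnormal_moment2_exp T)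
  moreover have "1 / (?c * det S) * (?c * det (matrix_inv ?Q) * ?r ^ k) = ?r ^ (k + 2)"
  proof -
    have "1 / (a * s) * (a * (1 / q) * z) = 1 / (s * q) * z" if "a > 0" for a s q z :: real
      using that by simp
    from this[OF c] have "1 / (?c * det S) * (?c * det (matrix_inv ?Q) * ?r ^ k) = 1 / (det S * det ?Q) * ?r ^ k"
      unfolding diQ .
    then show ?thesis by (simp only: power_add r2 mult.commute)
  qed
  ultimately have I: "has_bochner_integral (PiM {..<k} (\<lambda>_. mvnormal S))
      (\<lambda>X. (det (\<Sum>i<k. outer (X i) (X i)) / (?c * det S)) *\<^sub>R exp (- ((\<Sum>i<k. outer (X i) (X i)) \<bullet> T))) (?r ^ (k + 2))"
    by (simp add: exp_inner_sum_outer)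
  show ?thesis
    unfolding volume_sampling_def second_moment_mvnormal[OF S]
  proof (rule has_bochner_integral_density[OF _ _ _ I])
    \<comment> \<open>The density is defined through \<open>ennreal\<close>, which truncates
      negative reals to 0, so nonnegativity is needed to recover the real integrand.\<close>
    show "AE X in PiM {..<k} (\<lambda>_. mvnormal S). 0 \<le> det (\<Sum>i<k. outer (X i) (X i)) / (?c * det S)"
      by (intro AE_I2 divide_nonneg_pos det_sum_outer_nonneg mult_pos_pos[OF c dS] finite_lessThan)
  qed measurable
qed

theorem theorem3:
  fixes S :: "real^'d^'d" and k :: nat
  assumes "pos_def_matrix S"
    and "k \<ge> CARD('d)"
  shows "distr (volume_sampling k (mvnormal S)) borel (\<lambda>X. \<Sum>i<k. outer (X i) (X i))
         = wishart (k + 2) S"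
  unfolding wishart_def
proof (rule distr_eqI_laplace_transform)
  show "(\<lambda>X. \<Sum>i<k. outer (X i) (X i)) \<in> volume_sampling k (mvnormal S) \<rightarrow>\<^sub>M borel"
    using measurable_sum_outer by (simp add: volume_sampling_def)
  show "has_bochner_integral (volume_sampling k (mvnormal S)) (\<lambda>X. exp (- ((\<Sum>i<k. outer (X i) (X i)) \<bullet> T)))
      (((det S * det (matrix_inv S + (T + T))) powr (- 1 / 2)) ^ (k + 2))" if "pos_semidef_matrix T" for T
    by (rule has_bochner_integral_volume_sampling_laplace[OF assms(1) that assms(2)])
  show "has_bochner_integral (PiM {..<k + 2} (\<lambda>_. mvnormal S)) (\<lambda>X. exp (- ((\<Sum>i<k + 2. outer (X i) (X i)) \<bullet> T)))
      (((det S * det (matrix_inv S + (T + T))) powr (- 1 / 2)) ^ (k + 2))" if "pos_semidef_matrix T" for T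
    by (rule has_bochner_integral_wishart_laplace[OF assms(1) that])
qed (rule measurable_sum_outer pos_semidef_matrix_sum_outer)+

end
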